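(* Let $R$ be a ring, let $M=\bigoplus_{i=1}^n M_i$ be a direct sum of Euclidean $R$-modules $M_i$, let $0\neq A\in M_{m,n}(M_1,\ldots,M_n)$, let $N(A)$ be the $R$-submodule of $M$ generated by the rows of $A$, and let $\mathbb{P}_s(N(A))=\{j_1,\ldots,j_s\}$ with $j_1<\cdots<j_s$ be its strong pivot set. Then the matrix $A$ is strongly left-row equivalent to a matrix in strong reduced echelon form.
   Context: Rings are unital and modules are left modules. A poset is Artinian if every descending chain in it stabilizes. An $R$-module $E$ is a Euclidean module if there is a function $d_E:E\setminus\{0\}\to P$ to a poset $(P,\ge)$ (a Euclidean function, also called the degree) such that the poset $\mathrm{im}(d_E)$ is Artinian and, for any nonzero $u,v\in E$, there are $q\in R$ and $r\in E$ with $u=qv+r$ and either $r=0$ or $d_E(r)<d_E(v)$. For a nonzero submodule $N\subseteq E$, $g(N):=\min\{d_E(x): 0\ne x\in N\}$ (the least value; it is presupposed to exist). $M_{m,n}(M_1,\ldots,M_n)$ is the set of $m\times n$ matrices $(a_{ij})$ with $a_{ij}\in M_j$; the rows $a_i=(a_{i1},\ldots,a_{in})$ are elements of $M$, and $N(A):=\sum_i Ra_i$. Elementary row operations: (ER1) $a_i\mapsto a_i+\sum_{j\ne i}r_ja_j$ with $r_j\in R$; (ER2) swapping two rows; (ER0) replacing a zero row by $\sum_i r_ia_i$ with $r_i\in R$. Matrices are considered up to adding or deleting zero rows (so (ER0) amounts to adjoining a new row $\sum_i r_ia_i$). Matrices $A\in M_{m,n}(M_1,\ldots,M_n)$ and $A'\in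 M_{m',n}(M_1,\ldots,M_n)$ are strongly left-row equivalent, $A\sim_s A'$, if one can be obtained from the other by finitely many operations (ER0), (ER1), (ER2). Put $M_{\ge i}:=M_i\oplus\cdots\oplus M_n$, $M_{\ge n+1}:=0$. For a submodule $N\subseteq M$ let $N_{\ge i}:=N\cap M_{\ge i}$ and $\mathrm{gr}(N)_i:=N_{\ge i}/N_{\ge i+1}$, identified with a submodule of $M_{\ge i}/M_{\ge i+1}\simeq M_i$ (the image of $N_{\ge i}$ under projection to $M_i$). The strong pivot set is $\mathbb{P}_s(N):=\{i\in\{1,\ldots,n\}: \mathrm{gr}(N)_i\neq 0\}$. A nonzero matrix $B\in M_{s,n}(M_1,\ldots,M_n)$ with rows $b_1,\ldots,b_s$, where, for $N=N(B)$, $\mathbb{P}_s(N)=\{j_1<\cdots<j_s\}$, is in strong reduced echelon form if: (1) for each $\nu=1,\ldots,s$, $N_{\ge j_\nu}=\sum_{\mu=\nu}^s Rb_\mu$, and $b_{\nu j_\nu}\in M_{j_\nu}$ has the least degree among the nonzero elements of $\mathrm{gr}(N)_{j_\nu}=Rb_{\nu j_\nu}$; and (2) each of $b_{1j_\nu},\ldots,b_{\nu-1,j_\nu}$ is either zero or has degree strictly less than that of $b_{\nu j_\nu}$ in $M_{j_\nu}$. *)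

theory Defs
  imports "HOL-Algebra.Module"
begin

section \<open>Left modules and Euclidean modules\<close>

text \<open>The library locale \<open>module\<close> requires a commutative ring of scalars; this is the same
  axiom list over an arbitrary unital ring. As for \<open>module\<close>, only the additive part and
  the scalar action of the record are used; its \<open>mult\<close> and \<open>one\<close> fields are irrelevant.\<close>

locale left_module = R?: ring R + M?: abelian_group M
  for R :: "('a, 'r) ring_scheme" (structure) and M :: "('a, 'b) module" (structure) +
  assumes smult_closed [simp, intro]:
      "\<lbrakk>a \<in> carrier R; x \<in> carrier M\<rbrakk> \<Longrightarrow> a \<odot>\<^bsub>M\<^esub> x \<in> carrier M"
    and smult_l_distr:
      "\<lbrakk>a \<in> carrier R; b \<in> carrier R; x \<in> carrier M\<rbrakk> \<Longrightarrow>
        (a \<oplus>\<^bsub>R\<^esub> b) \<odot>\<^bsub>M\<^esub> x = a \<odot>\<^bsub>M\<^esub> x \<oplus>\<^bsub>M\<^esub> b \<odot>\<^bsub>M\<^esub> x"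
    and smult_r_distr:
      "\<lbrakk>a \<in> carrier R; x \<in> carrier M; y \<in> carrier M\<rbrakk> \<Longrightarrow>
        a \<odot>\<^bsub>M\<^esub> (x \<oplus>\<^bsub>M\<^esub> y) = a \<odot>\<^bsub>M\<^esub> x \<oplus>\<^bsub>M\<^esub> a \<odot>\<^bsub>M\<^esub> y"
    and smult_assoc1:
      "\<lbrakk>a \<in> carrier R; b \<in> carrier R; x \<in> carrier M\<rbrakk> \<Longrightarrow>
        (a \<otimes>\<^bsub>R\<^esub> b) \<odot>\<^bsub>M\<^esub> x = a \<odot>\<^bsub>M\<^esub> (b \<odot>\<^bsub>M\<^esub> x)"
    and smult_one [simp]:
      "x \<in> carrier M \<Longrightarrow> \<one>\<^bsub>R\<^esub> \<odot>\<^bsub>M\<^esub> x = x"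

definition artinian_subset :: "'p gorder \<Rightarrow> 'p set \<Rightarrow> bool" where
  "artinian_subset P S \<longleftrightarrow>
     (\<forall>f :: nat \<Rightarrow> 'p. (\<forall>k. f k \<in> S) \<and> (\<forall>k. f (Suc k) \<sqsubseteq>\<^bsub>P\<^esub> f k) \<longrightarrow> (\<exists>K. \<forall>k\<ge>K. f k = f K))"

definition nonzero :: "('a, 'b) module \<Rightarrow> 'b set \<Rightarrow> 'b set" where
  "nonzero E N = N - {\<zero>\<^bsub>E\<^esub>}"

text \<open>A Euclidean module together with its Euclidean function \<open>d\<close> into the poset \<open>P\<close>; the
  value of \<open>d\<close> at zero is unconstrained.\<close>

locale euclidean_module = E?: left_module R E + P?: partial_order P
  for R :: "('a, 'r) ring_scheme" and E :: "('a, 'b) module" and P :: "'p gorder" +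
  fixes d :: "'b \<Rightarrow> 'p"
  assumes degree_closed: "d \<in> nonzero E (carrier E) \<rightarrow> carrier P"
    and degree_artinian: "artinian_subset P (d ` nonzero E (carrier E))"
    and division:
      "\<lbrakk>u \<in> nonzero E (carrier E); v \<in> nonzero E (carrier E)\<rbrakk> \<Longrightarrow>
        \<exists>q\<in>carrier R. \<exists>r\<in>carrier E.
          u = q \<odot>\<^bsub>E\<^esub> v \<oplus>\<^bsub>E\<^esub> r \<and> (r = \<zero>\<^bsub>E\<^esub> \<or> d r \<sqsubset>\<^bsub>P\<^esub> d v)"

text \<open>\<open>is_g E P d N g\<close>: \<open>g\<close> is the least value (not just a minimal one) of the degree on
  the nonzero elements of \<open>N\<close>. Such a value need not exist for a general poset \<open>P\<close>.\<close>

definition is_g :: "('a, 'b) module \<Rightarrow> 'p gorder \<Rightarrow> ('b \<Rightarrow> 'p) \<Rightarrow> 'b set \<Rightarrow> 'p \<Rightarrow> bool" where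
  "is_g E P d N g \<longleftrightarrow> least P g (d ` nonzero E N)"

section \<open>Direct sums and matrices\<close>

text \<open>Elements of \<open>M\<^sub>1 \<oplus> \<dots> \<oplus> M\<^sub>n\<close> are functions on \<open>{1..n}\<close>, set to \<open>undefined\<close> elsewhere.\<close>

definition dsum :: "nat \<Rightarrow> (nat \<Rightarrow> ('a, 'b) module) \<Rightarrow> ('a, nat \<Rightarrow> 'b) module" where
  "dsum n M =
     \<lparr>carrier = (\<Pi>\<^sub>E i\<in>{1..n}. carrier (M i)),
      mult = undefined, one = undefined,
      zero = (\<lambda>i\<in>{1..n}. \<zero>\<^bsub>M i\<^esub>),
      add = (\<lambda>x y. \<lambda>i\<in>{1..n}. x i \<oplus>\<^bsub>M i\<^esub> y i),
      smult = (\<lambda>r x. \<lambda>i\<in>{1..n}. r \<odot>\<^bsub>M i\<^esub> x i)\<rparr>"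

lemma left_module_dsum:
  assumes "ring R" and M: "\<And>i. i \<in> {1..n} \<Longrightarrow> left_module R (M i)"
  shows "left_module R (dsum n M)"
proof -
  have ab: "abelian_group (M i)" if "i \<in> {1..n}" for i
    using M[OF that] by (simp add: left_module_def)
  have am: "abelian_monoid (M i)" if "Suc 0 \<le> i \<and> i \<le> n" for i
    using ab that by (auto intro: abelian_group.axioms)
  have "abelian_group (dsum n M)"
  proof (rule abelian_groupI)
    fix x assume x: "x \<in> carrier (dsum n M)"
    let ?y = "\<lambda>i\<in>{1..n}. \<ominus>\<^bsub>M i\<^esub> x i"
    show "\<exists>y\<in>carrier (dsum n M). y \<oplus>\<^bsub>dsum n M\<^esub> x = \<zero>\<^bsub>dsum n M\<^esub>"
      using x ab by (intro bexI[of _ ?y])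
        (auto simp: dsum_def PiE_iff abelian_group.l_neg abelian_group.a_inv_closed intro!: restrict_ext)
  qed (auto simp: dsum_def PiE_iff extensional_def fun_eq_iff am abelian_monoid.a_closed
    abelian_monoid.zero_closed abelian_monoid.a_assoc abelian_monoid.a_comm abelian_monoid.r_zero abelian_monoid.a_lcomm)
  then show ?thesis
    using assms(1) left_module.smult_closed[OF M] left_module.smult_l_distr[OF M] left_module.smult_r_distr[OF M]
      left_module.smult_assoc1[OF M] left_module.smult_one[OF M]
    by (intro left_module.intro left_module_axioms.intro)
      (auto simp: dsum_def PiE_iff extensional_def fun_eq_iff ring.ring_simprules)
qed

text \<open>A matrix is the list of its rows: the entry in row \<open>i\<close> and column \<open>j\<close> is \<open>(A ! i) j\<close>.
  Rows are numbered from \<open>0\<close>, columns from \<open>1\<close>.\<close>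

type_synonym 'b matrix = "(nat \<Rightarrow> 'b) list"

definition matrices :: "nat \<Rightarrow> nat \<Rightarrow> (nat \<Rightarrow> ('a, 'b) module) \<Rightarrow> 'b matrix set" where
  "matrices m n M = {A. length A = m \<and> set A \<subseteq> carrier (dsum n M)}"

definition zero_matrix :: "nat \<Rightarrow> nat \<Rightarrow> (nat \<Rightarrow> ('a, 'b) module) \<Rightarrow> 'b matrix" where
  "zero_matrix m n M = replicate m \<zero>\<^bsub>dsum n M\<^esub>"

text \<open>\<open>row_comb n M r A J\<close> is the sum of \<open>r\<^sub>j a\<^sub>j\<close> over \<open>j \<in> J\<close>.\<close>

definition row_comb ::
    "nat \<Rightarrow> (nat \<Rightarrow> ('a, 'b) module) \<Rightarrow> (nat \<Rightarrow> 'a) \<Rightarrow> 'b matrix \<Rightarrow> nat set \<Rightarrow> (nat \<Rightarrow> 'b)" where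
  "row_comb n M r A J = finsum (dsum n M) (\<lambda>j. r j \<odot>\<^bsub>dsum n M\<^esub> (A ! j)) J"

definition row_module ::
    "('a, 'r) ring_scheme \<Rightarrow> nat \<Rightarrow> (nat \<Rightarrow> ('a, 'b) module) \<Rightarrow> 'b matrix \<Rightarrow> (nat \<Rightarrow> 'b) set" where
  "row_module R n M A = {row_comb n M r A {..<length A} | r. r \<in> {..<length A} \<rightarrow> carrier R}"

section \<open>Strong left-row equivalence\<close>

text \<open>The rules \<open>add_zero\<close> and \<open>del_zero\<close> implement the convention that matrices are
  considered up to adding and deleting zero rows.\<close>

inductive row_step ::
    "('a, 'r) ring_scheme \<Rightarrow> nat \<Rightarrow> (nat \<Rightarrow> ('a, 'b) module) \<Rightarrow> 'b matrix \<Rightarrow> 'b matrix \<Rightarrow> bool"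
  for R :: "('a, 'r) ring_scheme" and n :: nat and M :: "nat \<Rightarrow> ('a, 'b) module" where
  ER0: "\<lbrakk>i < length A; A ! i = \<zero>\<^bsub>dsum n M\<^esub>; r \<in> {..<length A} \<rightarrow> carrier R\<rbrakk> \<Longrightarrow>
    row_step R n M A (A[i := row_comb n M r A {..<length A}])"
| ER1: "\<lbrakk>i < length A; r \<in> {..<length A} - {i} \<rightarrow> carrier R\<rbrakk> \<Longrightarrow>
    row_step R n M A (A[i := A ! i \<oplus>\<^bsub>dsum n M\<^esub> row_comb n M r A ({..<length A} - {i})])"
| ER2: "\<lbrakk>i < length A; k < length A\<rbrakk> \<Longrightarrow> row_step R n M A (A[i := A ! k, k := A ! i])"
| add_zero: "row_step R n M (A @ B) (A @ \<zero>\<^bsub>dsum n M\<^esub> # B)"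
| del_zero: "row_step R n M (A @ \<zero>\<^bsub>dsum n M\<^esub> # B) (A @ B)"

definition strongly_row_equiv ::
    "('a, 'r) ring_scheme \<Rightarrow> nat \<Rightarrow> (nat \<Rightarrow> ('a, 'b) module) \<Rightarrow> 'b matrix \<Rightarrow> 'b matrix \<Rightarrow> bool" where
  "strongly_row_equiv R n M = (row_step R n M)\<^sup>*\<^sup>*"

section \<open>Strong pivots and strong reduced echelon form\<close>

definition M_ge :: "nat \<Rightarrow> (nat \<Rightarrow> ('a, 'b) module) \<Rightarrow> nat \<Rightarrow> (nat \<Rightarrow> 'b) set" where
  "M_ge n M i = {x \<in> carrier (dsum n M). \<forall>k\<in>{1..n}. k < i \<longrightarrow> x k = \<zero>\<^bsub>M k\<^esub>}"

definition N_ge ::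
    "nat \<Rightarrow> (nat \<Rightarrow> ('a, 'b) module) \<Rightarrow> (nat \<Rightarrow> 'b) set \<Rightarrow> nat \<Rightarrow> (nat \<Rightarrow> 'b) set" where
  "N_ge n M N i = N \<inter> M_ge n M i"

text \<open>The quotient \<open>N\<^sub>\<ge>\<^sub>i / N\<^sub>\<ge>\<^sub>i\<^sub>+\<^sub>1\<close>, identified with the image of \<open>N\<^sub>\<ge>\<^sub>i\<close> under the
  projection to \<open>M\<^sub>i\<close>, the kernel of which on \<open>N\<^sub>\<ge>\<^sub>i\<close> is \<open>N\<^sub>\<ge>\<^sub>i\<^sub>+\<^sub>1\<close>.\<close>

definition gr :: "nat \<Rightarrow> (nat \<Rightarrow> ('a, 'b) module) \<Rightarrow> (nat \<Rightarrow> 'b) set \<Rightarrow> nat \<Rightarrow> 'b set" where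
  "gr n M N i = (\<lambda>x. x i) ` N_ge n M N i"

definition strong_pivots ::
    "nat \<Rightarrow> (nat \<Rightarrow> ('a, 'b) module) \<Rightarrow> (nat \<Rightarrow> 'b) set \<Rightarrow> nat set" where
  "strong_pivots n M N = {i \<in> {1..n}. gr n M N i \<noteq> {\<zero>\<^bsub>M i\<^esub>}}"

text \<open>\<open>drop \<nu> B\<close> consists of the rows of \<open>B\<close> with (0-based) index at least \<open>\<nu>\<close>.\<close>

definition strong_reduced_echelon ::
    "('a, 'r) ring_scheme \<Rightarrow> nat \<Rightarrow> (nat \<Rightarrow> ('a, 'b) module) \<Rightarrow> (nat \<Rightarrow> 'p gorder) \<Rightarrow>
      (nat \<Rightarrow> 'b \<Rightarrow> 'p) \<Rightarrow> 'b matrix \<Rightarrow> bool" where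
  "strong_reduced_echelon R n M P d B \<longleftrightarrow>
     (\<exists>s js. B \<in> matrices s n M \<and> B \<noteq> zero_matrix s n M \<and>
        length js = s \<and> sorted_wrt (<) js \<and> set js = strong_pivots n M (row_module R n M B) \<and>
        (\<forall>\<nu><s. let j = js ! \<nu>; N = row_module R n M B; b = (B ! \<nu>) j in
           N_ge n M N j = row_module R n M (drop \<nu> B) \<and>
           gr n M N j = {r \<odot>\<^bsub>M j\<^esub> b | r. r \<in> carrier R} \<and>
           b \<in> nonzero (M j) (gr n M N j) \<and>
           is_g (M j) (P j) (d j) (gr n M N j) (d j b) \<and>
           (\<forall>\<mu><\<nu>. (B ! \<mu>) j = \<zero>\<^bsub>M j\<^esub> \<or> d j ((B ! \<mu>) j) \<sqsubset>\<^bsub>P j\<^esub> d j b)))"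

end

theory Submission
  imports Defs
begin

text \<open>Put \<open>N = N(A)\<close>. For each strong pivot \<open>j\<close> choose \<open>c\<^sub>j \<in> N\<^sub>\<ge>\<^sub>j\<close> whose \<open>j\<close>-th entry has least
  degree in \<open>gr(N)\<^sub>j\<close>; division shows that this entry generates \<open>gr(N)\<^sub>j\<close>. Subtracting multiples of
  \<open>c\<^sub>k\<close> from \<open>c\<^sub>j\<close> for \<open>k = j + 1, \<dots>, n\<close> in this order makes the entries of \<open>c\<^sub>j\<close> at later pivots
  small and leaves its pivot entry unchanged. The rows so obtained form the echelon matrix \<open>B\<close>.
  No elimination algorithm is needed: as the rows of \<open>B\<close> lie in \<open>N(A)\<close>, (ER0) adjoins them to
  \<open>A\<close>, and as they generate \<open>N(A)\<close>, (ER1) then turns every row of \<open>A\<close> into zero.\<close>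

section \<open>Submodules over noncommutative rings\<close>

context left_module
begin

lemma smult_zero_right [simp]:
  assumes "a \<in> carrier R"
  shows "a \<odot>\<^bsub>M\<^esub> \<zero>\<^bsub>M\<^esub> = \<zero>\<^bsub>M\<^esub>"
proof -
  have "a \<odot>\<^bsub>M\<^esub> \<zero>\<^bsub>M\<^esub> \<oplus>\<^bsub>M\<^esub> a \<odot>\<^bsub>M\<^esub> \<zero>\<^bsub>M\<^esub> = a \<odot>\<^bsub>M\<^esub> \<zero>\<^bsub>M\<^esub>"
    using assms smult_r_distr[of a "\<zero>\<^bsub>M\<^esub>" "\<zero>\<^bsub>M\<^esub>"] by simp
  then show ?thesis
    using assms by simp
qed

lemma smult_zero_left [simp]:
  assumes "x \<in> carrier M"
  shows "\<zero> \<odot>\<^bsub>M\<^esub> x = \<zero>\<^bsub>M\<^esub>"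
proof -
  have "\<zero> \<odot>\<^bsub>M\<^esub> x \<oplus>\<^bsub>M\<^esub> \<zero> \<odot>\<^bsub>M\<^esub> x = \<zero> \<odot>\<^bsub>M\<^esub> x"
    using assms smult_l_distr[of "\<zero>" "\<zero>" x] by simp
  then show ?thesis
    using assms by simp
qed

lemma smult_minus_one:
  assumes "x \<in> carrier M"
  shows "(\<ominus> \<one>) \<odot>\<^bsub>M\<^esub> x = \<ominus>\<^bsub>M\<^esub> x"
proof -
  have "(\<ominus> \<one>) \<odot>\<^bsub>M\<^esub> x \<oplus>\<^bsub>M\<^esub> x = ((\<ominus> \<one>) \<oplus> \<one>) \<odot>\<^bsub>M\<^esub> x"
    using assms smult_l_distr[of "\<ominus> \<one>" "\<one>" x] by simp
  also have "\<dots> = \<zero>\<^bsub>M\<^esub>"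
    using assms by (simp add: R.l_neg)
  finally show ?thesis
    using assms by (simp add: M.minus_equality)
qed

text \<open>Closure under negatives follows from closure under scalars, since the ring is unital and
  -x is (-1)x.\<close>

lemma submoduleI:
  assumes "H \<subseteq> carrier M" and zero: "\<zero>\<^bsub>M\<^esub> \<in> H"
    and add: "\<And>x y. \<lbrakk>x \<in> H; y \<in> H\<rbrakk> \<Longrightarrow> x \<oplus>\<^bsub>M\<^esub> y \<in> H"
    and smult: "\<And>a x. \<lbrakk>a \<in> carrier R; x \<in> H\<rbrakk> \<Longrightarrow> a \<odot>\<^bsub>M\<^esub> x \<in> H"
  shows "submodule H R M"
proof -
  have "\<ominus>\<^bsub>M\<^esub> x \<in> H" if "x \<in> H" for x
    using smult[of "\<ominus> \<one>" x] smult_minus_one[of x] assms(1) that by auto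
  then show ?thesis
    using assms by (intro submodule.intro subgroup.intro submodule_axioms.intro)
      (auto simp: a_inv_def)
qed

lemma submodule_closed:
  assumes "submodule H R M"
  shows "x \<in> H \<Longrightarrow> x \<in> carrier M" and "\<zero>\<^bsub>M\<^esub> \<in> H"
    and "x \<in> H \<Longrightarrow> y \<in> H \<Longrightarrow> x \<oplus>\<^bsub>M\<^esub> y \<in> H"
    and "a \<in> carrier R \<Longrightarrow> x \<in> H \<Longrightarrow> a \<odot>\<^bsub>M\<^esub> x \<in> H"
    and "x \<in> H \<Longrightarrow> \<ominus>\<^bsub>M\<^esub> x \<in> H"
proof -
  interpret H: submodule H R M by fact
  show "x \<in> H \<Longrightarrow> x \<in> carrier M" and "\<zero>\<^bsub>M\<^esub> \<in> H"
    and "x \<in> H \<Longrightarrow> y \<in> H \<Longrightarrow> x \<oplus>\<^bsub>M\<^esub> y \<in> H"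
    and "a \<in> carrier R \<Longrightarrow> x \<in> H \<Longrightarrow> a \<odot>\<^bsub>M\<^esub> x \<in> H"
    and "x \<in> H \<Longrightarrow> \<ominus>\<^bsub>M\<^esub> x \<in> H"
    using H.subset H.one_closed H.m_closed H.m_inv_closed by (auto simp: a_inv_def)
qed

lemma submodule_minus_closed:
  assumes "submodule H R M" "x \<in> H" "y \<in> H"
  shows "x \<ominus>\<^bsub>M\<^esub> y \<in> H"
  using assms by (simp add: a_minus_def submodule_closed)

lemma submodule_Int:
  assumes "submodule H R M" "submodule K R M"
  shows "submodule (H \<inter> K) R M"
  using submodule_closed[OF assms(1)] submodule_closed[OF assms(2)]
  by (intro submoduleI) auto

end

section \<open>Spans of indexed families\<close>

text \<open>The index set is arbitrary, so that the span of all rows and the span of all rows but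
  one, which (ER1) uses, are both instances.\<close>

definition combs ::
    "('a, 'r) ring_scheme \<Rightarrow> ('a, 'b) module \<Rightarrow> ('i \<Rightarrow> 'b) \<Rightarrow> 'i set \<Rightarrow> 'b set" where
  "combs R E v J = {finsum E (\<lambda>j. r j \<odot>\<^bsub>E\<^esub> v j) J | r. r \<in> J \<rightarrow> carrier R}"

context left_module
begin

text \<open>With \<open>submodule_combs\<close> and \<open>combs_superset\<close> this identifies
  \<open>combs\<close> as the least submodule containing the family, so that most later arguments
  compare submodules and avoid coefficients.\<close>

lemma combs_minimal:
  assumes H: "submodule H R M" and "finite J" and v: "v ` J \<subseteq> H"
  shows "combs R M v J \<subseteq> H"
proof -
  have "finsum M (\<lambda>j. r j \<odot>\<^bsub>M\<^esub> v j) J \<in> H" if "r \<in> J \<rightarrow> carrier R" for r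
    using \<open>finite J\<close> v that
  proof (induction J)
    case empty
    then show ?case using submodule_closed[OF H] by simp
  next
    case (insert j J)
    then show ?case
      using submodule_closed[OF H] by (subst M.finsum_insert) (auto simp: Pi_iff)
  qed
  then show ?thesis by (auto simp: combs_def)
qed

lemma finsum_smult:
  assumes "finite J" "a \<in> carrier R" "f \<in> J \<rightarrow> carrier M"
  shows "a \<odot>\<^bsub>M\<^esub> finsum M f J = finsum M (\<lambda>j. a \<odot>\<^bsub>M\<^esub> f j) J"
  using assms
proof (induction J)
  case (insert j J)
  then show ?case
    by (simp add: M.finsum_insert Pi_iff smult_r_distr)
qed simp

lemma submodule_combs:
  assumes J: "finite J" and v: "v ` J \<subseteq> carrier M"
  shows "submodule (combs R M v J) R M"
proof -
  have vj: "v j \<in> carrier M" if "j \<in> J" for j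
    using v that by auto
  show ?thesis
  proof (rule submoduleI)
    show "combs R M v J \<subseteq> carrier M"
      by (auto simp: combs_def intro!: M.finsum_closed vj)
    have "finsum M (\<lambda>j. \<zero> \<odot>\<^bsub>M\<^esub> v j) J = \<zero>\<^bsub>M\<^esub>"
      using M.finsum_cong'[of J J "\<lambda>_. \<zero>\<^bsub>M\<^esub>" "\<lambda>j. \<zero> \<odot>\<^bsub>M\<^esub> v j"] by (simp add: vj)
    then show "\<zero>\<^bsub>M\<^esub> \<in> combs R M v J"
      by (auto simp: combs_def intro!: exI[of _ "\<lambda>_. \<zero>"])
  next
    fix x y assume "x \<in> combs R M v J" "y \<in> combs R M v J"
    then obtain r s where r: "r \<in> J \<rightarrow> carrier R" and x: "x = finsum M (\<lambda>j. r j \<odot>\<^bsub>M\<^esub> v j) J"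
      and s: "s \<in> J \<rightarrow> carrier R" and y: "y = finsum M (\<lambda>j. s j \<odot>\<^bsub>M\<^esub> v j) J"
      by (auto simp: combs_def)
    have "x \<oplus>\<^bsub>M\<^esub> y = finsum M (\<lambda>j. r j \<odot>\<^bsub>M\<^esub> v j \<oplus>\<^bsub>M\<^esub> s j \<odot>\<^bsub>M\<^esub> v j) J"
      unfolding x y using r s by (intro M.finsum_addf[symmetric]) (auto intro!: vj)
    also have "\<dots> = finsum M (\<lambda>j. (r j \<oplus> s j) \<odot>\<^bsub>M\<^esub> v j) J"
      using r s by (intro M.finsum_cong' refl) (auto simp: smult_l_distr vj Pi_iff)
    finally show "x \<oplus>\<^bsub>M\<^esub> y \<in> combs R M v J"
      using r s by (auto simp: combs_def intro!: exI[of _ "\<lambda>j. r j \<oplus> s j"])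
  next
    fix a x assume a: "a \<in> carrier R" and "x \<in> combs R M v J"
    then obtain r where r: "r \<in> J \<rightarrow> carrier R" and x: "x = finsum M (\<lambda>j. r j \<odot>\<^bsub>M\<^esub> v j) J"
      by (auto simp: combs_def)
    have "a \<odot>\<^bsub>M\<^esub> x = finsum M (\<lambda>j. a \<odot>\<^bsub>M\<^esub> (r j \<odot>\<^bsub>M\<^esub> v j)) J"
      unfolding x using r a J by (intro finsum_smult) (auto intro!: vj)
    also have "\<dots> = finsum M (\<lambda>j. (a \<otimes> r j) \<odot>\<^bsub>M\<^esub> v j) J"
      using r a by (intro M.finsum_cong' refl) (auto simp: smult_assoc1 vj Pi_iff)
    finally show "a \<odot>\<^bsub>M\<^esub> x \<in> combs R M v J"
      using r a by (auto simp: combs_def intro!: exI[of _ "\<lambda>j. a \<otimes> r j"])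
  qed
qed

lemma combs_superset:
  assumes J: "finite J" and v: "v ` J \<subseteq> carrier M"
  shows "v ` J \<subseteq> combs R M v J"
proof
  have vj: "v j \<in> carrier M" if "j \<in> J" for j
    using v that by auto
  fix x assume "x \<in> v ` J"
  then obtain i where i: "i \<in> J" "x = v i" by auto
  \<comment> \<open>Kronecker delta coefficients single out \<open>v i\<close>.\<close>
  have "finsum M (\<lambda>j. (if i = j then \<one> else \<zero>) \<odot>\<^bsub>M\<^esub> v j) J
      = finsum M (\<lambda>j. if i = j then v j else \<zero>\<^bsub>M\<^esub>) J"
    by (intro M.finsum_cong' refl) (auto simp: vj)
  also have "\<dots> = x"
    using i J by (auto simp: M.finsum_singleton vj)
  finally show "x \<in> combs R M v J"
    by (auto simp: combs_def intro!: exI[of _ "\<lambda>j. if i = j then \<one> else \<zero>"])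
qed

end

section \<open>Row modules and strong row equivalence\<close>

lemma row_module_eq_combs: "row_module R n M A = combs R (dsum n M) ((!) A) {..<length A}"
  by (simp add: row_module_def row_comb_def combs_def)

lemma nth_image_lessThan_length: "(!) A ` {..<length A} = set A"
  by (auto simp: set_conv_nth)

text \<open>Row equivalence is developed for arbitrary left modules as summands; division enters
  only with the echelon rows.\<close>

locale dsum_module =
  fixes R :: "('a, 'r) ring_scheme" (structure) and n :: nat and M :: "nat \<Rightarrow> ('a, 'b) module"
  assumes ring_R: "ring R" and summand: "\<And>i. i \<in> {1..n} \<Longrightarrow> left_module R (M i)"
begin

sublocale D: left_module R "dsum n M"
  by (rule left_module_dsum[OF ring_R summand])

lemma submodule_row_module:
  assumes "set A \<subseteq> carrier (dsum n M)"
  shows "submodule (row_module R n M A) R (dsum n M)"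
  unfolding row_module_eq_combs
  by (rule D.submodule_combs) (simp_all add: nth_image_lessThan_length assms)

lemma row_module_superset:
  assumes "set A \<subseteq> carrier (dsum n M)"
  shows "set A \<subseteq> row_module R n M A"
  unfolding row_module_eq_combs
  using D.combs_superset[of "{..<length A}" "(!) A"] assms by (simp add: nth_image_lessThan_length)

lemma row_module_minimal:
  assumes "submodule H R (dsum n M)" "set A \<subseteq> H"
  shows "row_module R n M A \<subseteq> H"
  unfolding row_module_eq_combs
  using assms by (intro D.combs_minimal) (simp_all add: nth_image_lessThan_length)

lemma row_module_mono:
  assumes "set B \<subseteq> carrier (dsum n M)" "set A \<subseteq> set B"
  shows "row_module R n M A \<subseteq> row_module R n M B"
  using assms row_module_superset[OF assms(1)]
  by (intro row_module_minimal submodule_row_module) auto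

section \<open>Adjoining and removing rows\<close>

text \<open>(ER0) overwrites a zero row, so one is first put on top of \<open>A\<close>. This keeps
  \<open>x\<close> in the row module, and \<open>x\<close> then replaces the zero row.\<close>

lemma adjoin_row:
  assumes A: "set A \<subseteq> carrier (dsum n M)" and x: "x \<in> row_module R n M A"
  shows "strongly_row_equiv R n M A (x # A)"
proof -
  let ?Z = "\<zero>\<^bsub>dsum n M\<^esub> # A"
  have "x \<in> row_module R n M ?Z"
    using row_module_mono[of ?Z A] A x by auto
  then obtain r where "r \<in> {..<length ?Z} \<rightarrow> carrier R" "x = row_comb n M r ?Z {..<length ?Z}"
    by (auto simp: row_module_def)
  then have "row_step R n M ?Z (x # A)"
    using row_step.ER0[of 0 ?Z n M r R] by simp
  then show ?thesis
    using row_step.add_zero[of R n M "[]" A] unfolding strongly_row_equiv_def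
    by (simp add: converse_rtranclp_into_rtranclp)
qed

lemma adjoin_rows:
  assumes A: "set A \<subseteq> carrier (dsum n M)" and "set B \<subseteq> row_module R n M A"
  shows "strongly_row_equiv R n M A (B @ A)"
  using assms(2)
proof (induction B)
  case Nil
  then show ?case by (simp add: strongly_row_equiv_def)
next
  case (Cons b B)
  have "set (B @ A) \<subseteq> carrier (dsum n M)"
    using A Cons.prems D.submodule_closed(1)[OF submodule_row_module[OF A]] by auto
  \<comment> \<open>The rows adjoined so far only enlarge the row module, so \<open>b\<close> is
    still a combination of the present rows.\<close>
  then have "strongly_row_equiv R n M (B @ A) (b # B @ A)"
    using Cons.prems row_module_mono[of "B @ A" A] by (intro adjoin_row) auto
  with Cons show ?case by (auto simp: strongly_row_equiv_def)
qed

text \<open>(ER1) adds to a row only multiples of the other rows. The rows of \<open>B\<close> are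
  among these and generate \<open>a\<close>, so -a can be added; the zero row that results is
  deleted.\<close>

lemma remove_row:
  assumes C: "set (B @ a # A) \<subseteq> carrier (dsum n M)" and a: "a \<in> row_module R n M B"
  shows "strongly_row_equiv R n M (B @ a # A) (B @ A)"
proof -
  let ?C = "B @ a # A" and ?i = "length B"
  let ?J = "{..<length ?C} - {?i}"
  let ?S = "combs R (dsum n M) ((!) ?C) ?J"
  have J: "finite ?J" "(!) ?C ` ?J \<subseteq> carrier (dsum n M)"
    using C nth_mem[of _ ?C] by blast+
  have "set B \<subseteq> (!) ?C ` ?J"
  proof
    fix b assume "b \<in> set B"
    then obtain k where "k < length B" "b = B ! k" by (auto simp: set_conv_nth)
    then show "b \<in> (!) ?C ` ?J" by (intro image_eqI[of _ _ k]) (auto simp: nth_append)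
  qed
  then have "row_module R n M B \<subseteq> ?S"
    using D.combs_superset[OF J] by (intro row_module_minimal D.submodule_combs[OF J]) auto
  then have "\<ominus>\<^bsub>dsum n M\<^esub> a \<in> ?S"
    using a D.submodule_closed(5)[OF D.submodule_combs[OF J]] by auto
  then obtain r where r: "r \<in> ?J \<rightarrow> carrier R" "\<ominus>\<^bsub>dsum n M\<^esub> a = row_comb n M r ?C ?J"
    unfolding combs_def row_comb_def by blast
  have "?C[?i := ?C ! ?i \<oplus>\<^bsub>dsum n M\<^esub> row_comb n M r ?C ?J] = B @ \<zero>\<^bsub>dsum n M\<^esub> # A"
    unfolding r(2)[symmetric] using C by (simp add: D.M.r_neg)
  moreover have "row_step R n M ?C (?C[?i := ?C ! ?i \<oplus>\<^bsub>dsum n M\<^esub> row_comb n M r ?C ?J])"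
    using r(1) by (intro row_step.ER1) auto
  ultimately have "row_step R n M ?C (B @ \<zero>\<^bsub>dsum n M\<^esub> # A)"
    by simp
  then show ?thesis
    using row_step.del_zero[of R n M B A] unfolding strongly_row_equiv_def
    by (simp add: converse_rtranclp_into_rtranclp)
qed

text \<open>\<open>B\<close> stays fixed while the rows of \<open>A\<close> disappear one at a time,
  so each of them is still a combination of \<open>B\<close> when its turn comes.\<close>

lemma remove_rows:
  assumes "set B \<subseteq> carrier (dsum n M)" "set A \<subseteq> row_module R n M B"
  shows "strongly_row_equiv R n M (B @ A) B"
  using assms(2)
proof (induction A)
  case Nil
  then show ?case by (simp add: strongly_row_equiv_def)
next
  case (Cons a A)
  have "strongly_row_equiv R n M (B @ a # A) (B @ A)"
    using assms(1) Cons.prems D.submodule_closed(1)[OF submodule_row_module[OF assms(1)]]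
    by (intro remove_row) auto
  with Cons show ?case by (auto simp: strongly_row_equiv_def)
qed

text \<open>The chain passes through \<open>B @ A\<close>: first \<open>A\<close> generates the rows
  to adjoin, then \<open>B\<close> generates the rows to remove.\<close>

lemma strongly_row_equiv_if_row_module_eq:
  assumes A: "set A \<subseteq> carrier (dsum n M)" and B: "set B \<subseteq> carrier (dsum n M)"
    and eq: "row_module R n M A = row_module R n M B"
  shows "strongly_row_equiv R n M A B"
  using adjoin_rows[OF A, of B] remove_rows[OF B, of A]
    row_module_superset[OF A] row_module_superset[OF B]
  unfolding eq strongly_row_equiv_def by simp

section \<open>Entries, the column filtration and its graded pieces\<close>

lemma carrier_dsum_entry: "x \<in> carrier (dsum n M) \<Longrightarrow> i \<in> {1..n} \<Longrightarrow> x i \<in> carrier (M i)"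
  by (auto simp: dsum_def)

lemma dsum_entries:
  assumes "i \<in> {1..n}"
  shows "(x \<oplus>\<^bsub>dsum n M\<^esub> y) i = x i \<oplus>\<^bsub>M i\<^esub> y i" "(a \<odot>\<^bsub>dsum n M\<^esub> x) i = a \<odot>\<^bsub>M i\<^esub> x i"
    "\<zero>\<^bsub>dsum n M\<^esub> i = \<zero>\<^bsub>M i\<^esub>"
  using assms by (simp_all add: dsum_def)

lemma dsum_minus_entry:
  assumes "i \<in> {1..n}" "x \<in> carrier (dsum n M)" "y \<in> carrier (dsum n M)"
  shows "(x \<ominus>\<^bsub>dsum n M\<^esub> y) i = x i \<ominus>\<^bsub>M i\<^esub> y i"
proof -
  interpret left_module R "M i" by (rule summand[OF assms(1)])
  show ?thesis
    \<comment> \<open>Negatives are not entrywise by definition, but scalar multiples are; hence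
      negatives on both sides are rewritten as multiples by -1.\<close>
    using assms D.smult_minus_one[of y, symmetric] smult_minus_one[of "y i", symmetric]
    by (simp add: a_minus_def dsum_entries carrier_dsum_entry)
qed

lemma submodule_M_ge: "submodule (M_ge n M i) R (dsum n M)"
proof (rule D.submoduleI)
  have *: "\<zero>\<^bsub>M k\<^esub> \<oplus>\<^bsub>M k\<^esub> \<zero>\<^bsub>M k\<^esub> = \<zero>\<^bsub>M k\<^esub>"
    "a \<in> carrier R \<Longrightarrow> a \<odot>\<^bsub>M k\<^esub> \<zero>\<^bsub>M k\<^esub> = \<zero>\<^bsub>M k\<^esub>" if "k \<in> {1..n}" for k a
  proof -
    interpret left_module R "M k" by (rule summand[OF that])
    show "\<zero>\<^bsub>M k\<^esub> \<oplus>\<^bsub>M k\<^esub> \<zero>\<^bsub>M k\<^esub> = \<zero>\<^bsub>M k\<^esub>"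
      and "a \<in> carrier R \<Longrightarrow> a \<odot>\<^bsub>M k\<^esub> \<zero>\<^bsub>M k\<^esub> = \<zero>\<^bsub>M k\<^esub>" by simp_all
  qed
  show "\<zero>\<^bsub>dsum n M\<^esub> \<in> M_ge n M i"
    by (auto simp: M_ge_def dsum_entries)
  show "x \<oplus>\<^bsub>dsum n M\<^esub> y \<in> M_ge n M i" if "x \<in> M_ge n M i" "y \<in> M_ge n M i" for x y
    using that * by (auto simp: M_ge_def dsum_entries)
  show "a \<odot>\<^bsub>dsum n M\<^esub> x \<in> M_ge n M i" if "a \<in> carrier R" "x \<in> M_ge n M i" for a x
    using that * by (auto simp: M_ge_def dsum_entries)
qed (auto simp: M_ge_def)

lemma submodule_N_ge:
  assumes "submodule N R (dsum n M)"
  shows "submodule (N_ge n M N i) R (dsum n M)"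
  unfolding N_ge_def by (rule D.submodule_Int[OF assms submodule_M_ge])

text \<open>The projection to \<open>M i\<close> is linear on \<open>N_ge n M N i\<close>. Least
  degrees and division thus become available in each graded piece.\<close>

lemma submodule_gr:
  assumes N: "submodule N R (dsum n M)" and i: "i \<in> {1..n}"
  shows "submodule (gr n M N i) R (M i)"
proof -
  interpret left_module R "M i" by (rule summand[OF i])
  note cl = D.submodule_closed[OF submodule_N_ge[OF N, of i]]
  show ?thesis
  proof (rule submoduleI)
    show "gr n M N i \<subseteq> carrier (M i)"
      using cl(1) i by (auto simp: gr_def carrier_dsum_entry)
    show "\<zero>\<^bsub>M i\<^esub> \<in> gr n M N i"
      using cl(2) i by (auto simp: gr_def dsum_entries image_iff intro!: bexI[of _ "\<zero>\<^bsub>dsum n M\<^esub>"])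
    show "x \<oplus>\<^bsub>M i\<^esub> y \<in> gr n M N i" if "x \<in> gr n M N i" "y \<in> gr n M N i" for x y
      using that cl(3) dsum_entries(1)[OF i, symmetric] by (auto simp: gr_def)
    show "a \<odot>\<^bsub>M i\<^esub> x \<in> gr n M N i" if "a \<in> carrier R" "x \<in> gr n M N i" for a x
      using that cl(4) dsum_entries(2)[OF i, symmetric] by (auto simp: gr_def)
  qed
qed

end

section \<open>Division with least-degree divisors\<close>

context euclidean_module
begin

text \<open>The division axiom speaks of nonzero \<open>u\<close>; here \<open>q = 0\<close> covers
  \<open>u = 0\<close>. Writing the remainder as a difference makes it visible that it stays in any
  submodule containing \<open>u\<close> and \<open>v\<close>.\<close>

lemma division_remainder:
  assumes u: "u \<in> carrier E" and v: "v \<in> carrier E" "v \<noteq> \<zero>\<^bsub>E\<^esub>"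
  shows "\<exists>q\<in>carrier R. u \<ominus>\<^bsub>E\<^esub> q \<odot>\<^bsub>E\<^esub> v = \<zero>\<^bsub>E\<^esub> \<or> d (u \<ominus>\<^bsub>E\<^esub> q \<odot>\<^bsub>E\<^esub> v) \<sqsubset>\<^bsub>P\<^esub> d v"
proof (cases "u = \<zero>\<^bsub>E\<^esub>")
  case True
  then show ?thesis
    using v by (intro bexI[of _ "\<zero>\<^bsub>R\<^esub>"]) (simp_all add: a_minus_def)
next
  case False
  then obtain q r where q: "q \<in> carrier R" and r: "r \<in> carrier E"
    and u_eq: "u = q \<odot>\<^bsub>E\<^esub> v \<oplus>\<^bsub>E\<^esub> r" and small: "r = \<zero>\<^bsub>E\<^esub> \<or> d r \<sqsubset>\<^bsub>P\<^esub> d v"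
    using division[of u v] u v by (auto simp: nonzero_def)
  have "u \<ominus>\<^bsub>E\<^esub> q \<odot>\<^bsub>E\<^esub> v = r"
    using q r v unfolding u_eq
    by (simp add: a_minus_def E.M.a_comm[of _ r] E.M.a_assoc E.M.r_neg)
  with q small show ?thesis by auto
qed

text \<open>Dividing any \<open>u\<close> in \<open>H\<close> by \<open>b\<close> leaves a remainder
  in \<open>H\<close>; were it nonzero, its degree would be strictly below the least one.\<close>

lemma least_degree_generates:
  assumes H: "submodule H R E" and b: "b \<in> nonzero E H" and g: "is_g E P d H (d b)"
  shows "H = {r \<odot>\<^bsub>E\<^esub> b | r. r \<in> carrier R}"
proof
  have bH: "b \<in> H" "b \<noteq> \<zero>\<^bsub>E\<^esub>" "b \<in> carrier E"
    using b E.submodule_closed[OF H] by (auto simp: nonzero_def)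
  show "{r \<odot>\<^bsub>E\<^esub> b | r. r \<in> carrier R} \<subseteq> H"
    using bH E.submodule_closed[OF H] by auto
  show "H \<subseteq> {r \<odot>\<^bsub>E\<^esub> b | r. r \<in> carrier R}"
  proof
    fix u assume u: "u \<in> H"
    then have uE: "u \<in> carrier E" using E.submodule_closed[OF H] by auto
    then obtain q where q: "q \<in> carrier R"
      and small: "u \<ominus>\<^bsub>E\<^esub> q \<odot>\<^bsub>E\<^esub> b = \<zero>\<^bsub>E\<^esub> \<or> d (u \<ominus>\<^bsub>E\<^esub> q \<odot>\<^bsub>E\<^esub> b) \<sqsubset>\<^bsub>P\<^esub> d b"
      using division_remainder[OF _ bH(3,2)] by blast
    let ?r = "u \<ominus>\<^bsub>E\<^esub> q \<odot>\<^bsub>E\<^esub> b"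
    have rH: "?r \<in> H"
      using u q bH E.submodule_closed(4)[OF H] by (intro E.submodule_minus_closed[OF H]) auto
    have "?r = \<zero>\<^bsub>E\<^esub>"
    proof (rule ccontr)
      assume nz: "?r \<noteq> \<zero>\<^bsub>E\<^esub>"
      with rH have "?r \<in> nonzero E H" by (simp add: nonzero_def)
      then have le: "d b \<sqsubseteq>\<^bsub>P\<^esub> d ?r" and "d b \<in> carrier P" "d ?r \<in> carrier P"
        using g b by (auto simp: is_g_def least_def)
      moreover have "d ?r \<sqsubseteq>\<^bsub>P\<^esub> d b" "d ?r \<noteq> d b"
        using small nz by (auto simp: lless_def eq_is_equal)
      ultimately show False using le_antisym by (auto simp: eq_is_equal)
    qed
    \<comment> \<open>The sum of \<open>u\<close> and the negative of qb is zero, so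
      \<open>u\<close> is the double negative of qb.\<close>
    then have "u = q \<odot>\<^bsub>E\<^esub> b"
      using uE q bH E.M.minus_equality[of u "\<ominus>\<^bsub>E\<^esub> (q \<odot>\<^bsub>E\<^esub> b)"] by (simp add: a_minus_def)
    with q show "u \<in> {r \<odot>\<^bsub>E\<^esub> b | r. r \<in> carrier R}" by auto
  qed
qed

end

section \<open>Constructing the reduced echelon rows\<close>

locale euclidean_dsum =
  fixes R :: "('a, 'r) ring_scheme" (structure) and n :: nat and M :: "nat \<Rightarrow> ('a, 'b) module"
    and P :: "nat \<Rightarrow> 'p gorder" and d :: "nat \<Rightarrow> 'b \<Rightarrow> 'p"
  assumes is_ring: "ring R"
    and euclidean: "\<And>i. i \<in> {1..n} \<Longrightarrow> euclidean_module R (M i) (P i) (d i)"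
begin

sublocale dsum_module R n M
  using is_ring euclidean by (auto simp: dsum_module_def euclidean_module_def)

lemma reduce_entries:
  assumes N: "submodule N R (dsum n M)" and x: "x \<in> N" and K: "K \<subseteq> {1..n}"
    and c: "\<And>k. k \<in> K \<Longrightarrow> c k \<in> N_ge n M N k \<and> c k k \<noteq> \<zero>\<^bsub>M k\<^esub>"
  shows "\<exists>y\<in>N. (\<forall>i\<in>{1..n}. i \<le> j \<longrightarrow> y i = x i) \<and>
    (\<forall>k\<in>K. j < k \<and> k \<le> l \<longrightarrow> y k = \<zero>\<^bsub>M k\<^esub> \<or> d k (y k) \<sqsubset>\<^bsub>P k\<^esub> d k (c k k))"
proof (induction l)
  case 0
  then show ?case using x by (intro bexI[of _ x]) auto
next
  case (Suc l)
  let ?k = "Suc l"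
  from Suc obtain y where y: "y \<in> N" "\<forall>i\<in>{1..n}. i \<le> j \<longrightarrow> y i = x i"
    and small: "\<forall>k\<in>K. j < k \<and> k \<le> l \<longrightarrow> y k = \<zero>\<^bsub>M k\<^esub> \<or> d k (y k) \<sqsubset>\<^bsub>P k\<^esub> d k (c k k)"
    by blast
  show ?case
  proof (cases "?k \<in> K \<and> j < ?k")
    case False
    then show ?thesis using y small by (intro bexI[of _ y]) (auto simp: le_Suc_eq)
  next
    case True
    then have k: "?k \<in> {1..n}" using K by auto
    interpret E: euclidean_module R "M ?k" "P ?k" "d ?k" by (rule euclidean[OF k])
    have cN: "c ?k \<in> N" "c ?k \<in> carrier (dsum n M)" "c ?k ?k \<noteq> \<zero>\<^bsub>M ?k\<^esub>"
      and c0: "\<And>i. i \<in> {1..n} \<Longrightarrow> i < ?k \<Longrightarrow> c ?k i = \<zero>\<^bsub>M i\<^esub>"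
      using c[of ?k] True by (auto simp: N_ge_def M_ge_def)
    have yD: "y \<in> carrier (dsum n M)" using y(1) D.submodule_closed(1)[OF N] by auto
    \<comment> \<open>The quotient by the pivot entry tells which multiple of the whole row
      \<open>c ?k\<close> to subtract.\<close>
    obtain q where q: "q \<in> carrier R" and
      qs: "y ?k \<ominus>\<^bsub>M ?k\<^esub> q \<odot>\<^bsub>M ?k\<^esub> c ?k ?k = \<zero>\<^bsub>M ?k\<^esub> \<or>
        d ?k (y ?k \<ominus>\<^bsub>M ?k\<^esub> q \<odot>\<^bsub>M ?k\<^esub> c ?k ?k) \<sqsubset>\<^bsub>P ?k\<^esub> d ?k (c ?k ?k)"
      using E.division_remainder[of "y ?k" "c ?k ?k"] carrier_dsum_entry[OF _ k] cN yD by blast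
    let ?y = "y \<ominus>\<^bsub>dsum n M\<^esub> q \<odot>\<^bsub>dsum n M\<^esub> c ?k"
    have entry: "?y i = y i \<ominus>\<^bsub>M i\<^esub> q \<odot>\<^bsub>M i\<^esub> c ?k i" if "i \<in> {1..n}" for i
      using that q yD cN(2) by (simp add: dsum_minus_entry dsum_entries)
    have same: "?y i = y i" if i: "i \<in> {1..n}" "i < ?k" for i
    proof -
      interpret Mi: left_module R "M i" by (rule summand[OF i(1)])
      show ?thesis
        unfolding entry[OF i(1)] using q c0[OF i] carrier_dsum_entry[OF yD i(1)]
        by (simp add: a_minus_def)
    qed
    have "?y \<in> N"
      using y(1) q cN(1) D.submodule_closed(4)[OF N] by (intro D.submodule_minus_closed[OF N]) auto
    moreover have "\<forall>i\<in>{1..n}. i \<le> j \<longrightarrow> ?y i = x i"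
      using same y(2) True by auto
    moreover have "?y k = \<zero>\<^bsub>M k\<^esub> \<or> d k (?y k) \<sqsubset>\<^bsub>P k\<^esub> d k (c k k)"
      if "k \<in> K" "j < k" "k \<le> ?k" for k
    proof (cases "k = ?k")
      case True
      then show ?thesis using qs entry[OF k] by simp
    next
      case False
      with that K have "k \<in> {1..n}" "k < ?k" "k \<le> l" by auto
      then show ?thesis using small same[of k] that by simp
    qed
    ultimately show ?thesis by blast
  qed
qed

text \<open>Descending induction along the filtration: at a pivot \<open>k\<close> the entry
  \<open>x k\<close> is a multiple of \<open>b k k\<close>, and subtracting that multiple of
  \<open>b k\<close> moves \<open>x\<close> one filtration step down. Starting from
  \<open>i\<close>, only rows with pivot at least \<open>i\<close> are used.\<close>

lemma N_ge_generated:
  assumes N: "submodule N R (dsum n M)" and H: "submodule H R (dsum n M)"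
    and b: "\<And>j. j \<in> strong_pivots n M N \<Longrightarrow> i \<le> j \<Longrightarrow> b j \<in> N_ge n M N j \<inter> H"
    and gen: "\<And>j. j \<in> strong_pivots n M N \<Longrightarrow> gr n M N j = {r \<odot>\<^bsub>M j\<^esub> b j j | r. r \<in> carrier R}"
  shows "N_ge n M N i \<subseteq> H"
proof -
  have "x \<in> H" if "x \<in> N_ge n M N k" "i \<le> k" "k \<le> Suc n" for x k
    using that(3,1,2)
  proof (induction k arbitrary: x rule: inc_induct)
    \<comment> \<open>At index \<open>n + 1\<close> all entries vanish, and outside
      \<open>{1..n}\<close> every element is \<open>undefined\<close>, so \<open>x\<close> is the
      zero of the direct sum.\<close>
    case base
    then have "x = \<zero>\<^bsub>dsum n M\<^esub>"
      by (auto simp: N_ge_def M_ge_def dsum_def PiE_iff extensional_def fun_eq_iff)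
    then show ?case using D.submodule_closed(2)[OF H] by simp
  next
    case (step k)
    have xN: "x \<in> N" and xD: "x \<in> carrier (dsum n M)"
      and x0: "\<And>l. l \<in> {1..n} \<Longrightarrow> l < k \<Longrightarrow> x l = \<zero>\<^bsub>M l\<^esub>"
      using step.prems by (auto simp: N_ge_def M_ge_def)
    have xk: "x k \<in> gr n M N k" using step.prems by (auto simp: gr_def)
    show ?case
    proof (cases "k \<in> strong_pivots n M N")
      \<comment> \<open>A column that is not a pivot has zero graded piece, so \<open>x\<close>
        already vanishes there; \<open>k = 0\<close> is no column at all.\<close>
      case False
      have "x l = \<zero>\<^bsub>M l\<^esub>" if "l \<in> {1..n}" "l < Suc k" for l
        using x0[of l] xk False that by (cases "l = k") (auto simp: strong_pivots_def)
      then have "x \<in> N_ge n M N (Suc k)" using xN xD by (auto simp: N_ge_def M_ge_def)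
      then show ?thesis using step by simp
    next
      case True
      then have k: "k \<in> {1..n}" by (simp add: strong_pivots_def)
      from gen[OF True] xk obtain r where r: "r \<in> carrier R" "x k = r \<odot>\<^bsub>M k\<^esub> b k k" by auto
      have bk: "b k \<in> N" "b k \<in> H" "b k \<in> carrier (dsum n M)"
        and b0: "\<And>l. l \<in> {1..n} \<Longrightarrow> l < k \<Longrightarrow> b k l = \<zero>\<^bsub>M l\<^esub>"
        using b[OF True] step.prems by (auto simp: N_ge_def M_ge_def)
      let ?t = "r \<odot>\<^bsub>dsum n M\<^esub> b k"
      let ?y = "x \<ominus>\<^bsub>dsum n M\<^esub> ?t"
      have t: "?t \<in> N" "?t \<in> H" "?t \<in> carrier (dsum n M)"
        using r bk D.submodule_closed(4)[OF N] D.submodule_closed(4)[OF H] by auto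
      have "?y l = \<zero>\<^bsub>M l\<^esub>" if l: "l \<in> {1..n}" "l < Suc k" for l
      proof -
        interpret Ml: left_module R "M l" by (rule summand[OF l(1)])
        have "?y l = x l \<ominus>\<^bsub>M l\<^esub> r \<odot>\<^bsub>M l\<^esub> b k l"
          using l xD t by (simp add: dsum_minus_entry dsum_entries)
        \<comment> \<open>For \<open>l = k\<close> this is the choice of \<open>r\<close>; in
          earlier columns both sides are zero.\<close>
        also have "r \<odot>\<^bsub>M l\<^esub> b k l = x l"
          using r x0[of l] b0[of l] l by (cases "l = k") auto
        finally show ?thesis
          using carrier_dsum_entry[OF xD l(1)] by (simp add: a_minus_def Ml.M.r_neg)
      qed
      moreover have "?y \<in> N" using xN t D.submodule_minus_closed[OF N] by auto
      ultimately have "?y \<in> N_ge n M N (Suc k)"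
        using xD t by (auto simp: N_ge_def M_ge_def)
      then have "?y \<in> H" using step by simp
      then have "?y \<oplus>\<^bsub>dsum n M\<^esub> ?t \<in> H" using t D.submodule_closed(3)[OF H] by auto
      also have "?y \<oplus>\<^bsub>dsum n M\<^esub> ?t = x"
        using xD t by (simp add: a_minus_def D.M.a_assoc D.M.l_neg)
      finally show ?thesis .
    qed
  qed
  \<comment> \<open>Beyond \<open>n + 1\<close> the filtration remains zero.\<close>
  moreover have "N_ge n M N i \<subseteq> H" if "\<not> i \<le> Suc n"
  proof
    fix x assume "x \<in> N_ge n M N i"
    then have "x = \<zero>\<^bsub>dsum n M\<^esub>"
      using that by (auto simp: N_ge_def M_ge_def dsum_def PiE_iff extensional_def fun_eq_iff)
    then show "x \<in> H" using D.submodule_closed(2)[OF H] by simp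
  qed
  ultimately show ?thesis by blast
qed

text \<open>Every row is reduced against the unreduced rows \<open>c k\<close>, so the rows can be
  treated independently. Since reduction preserves pivot entries, a bound by the degree of
  \<open>c k k\<close> is also one by that of \<open>b k k\<close>.\<close>

lemma strong_echelon_basis_exists:
  assumes N: "submodule N R (dsum n M)"
    and g: "\<And>j. j \<in> strong_pivots n M N \<Longrightarrow> \<exists>g. is_g (M j) (P j) (d j) (gr n M N j) g"
  shows "\<exists>b. \<forall>j\<in>strong_pivots n M N. b j \<in> N_ge n M N j \<and>
    b j j \<in> nonzero (M j) (gr n M N j) \<and> is_g (M j) (P j) (d j) (gr n M N j) (d j (b j j)) \<and>
    (\<forall>k\<in>strong_pivots n M N. j < k \<longrightarrow> b j k = \<zero>\<^bsub>M k\<^esub> \<or> d k (b j k) \<sqsubset>\<^bsub>P k\<^esub> d k (b k k))"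
proof -
  let ?K = "strong_pivots n M N"
  have "\<forall>j\<in>?K. \<exists>c. c \<in> N_ge n M N j \<and> c j \<in> nonzero (M j) (gr n M N j) \<and>
      is_g (M j) (P j) (d j) (gr n M N j) (d j (c j))"
  proof
    fix j assume "j \<in> ?K"
    with g obtain h where h: "is_g (M j) (P j) (d j) (gr n M N j) h" by blast
    then have "h \<in> d j ` nonzero (M j) (gr n M N j)" by (simp add: is_g_def least_def)
    then obtain u where u: "u \<in> nonzero (M j) (gr n M N j)" "h = d j u" by auto
    then obtain c where "c \<in> N_ge n M N j" "u = c j" by (auto simp: nonzero_def gr_def)
    with u h show "\<exists>c. c \<in> N_ge n M N j \<and> c j \<in> nonzero (M j) (gr n M N j) \<and>
      is_g (M j) (P j) (d j) (gr n M N j) (d j (c j))" by blast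
  qed
  then obtain c where c: "\<forall>j\<in>?K. c j \<in> N_ge n M N j \<and> c j j \<in> nonzero (M j) (gr n M N j) \<and>
      is_g (M j) (P j) (d j) (gr n M N j) (d j (c j j))"
    by metis
  \<comment> \<open>Taking \<open>l = n\<close> covers all pivots after \<open>j\<close>. Freezing
    the columns up to \<open>j\<close> keeps the pivot entry and the zeros before it.\<close>
  have "\<exists>y\<in>N. (\<forall>i\<in>{1..n}. i \<le> j \<longrightarrow> y i = c j i) \<and>
      (\<forall>k\<in>?K. j < k \<and> k \<le> n \<longrightarrow> y k = \<zero>\<^bsub>M k\<^esub> \<or> d k (y k) \<sqsubset>\<^bsub>P k\<^esub> d k (c k k))"
    if "j \<in> ?K" for j
    using c that by (intro reduce_entries[OF N]) (auto simp: N_ge_def nonzero_def strong_pivots_def)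
  then obtain b where b: "\<forall>j\<in>?K. b j \<in> N \<and> (\<forall>i\<in>{1..n}. i \<le> j \<longrightarrow> b j i = c j i) \<and>
      (\<forall>k\<in>?K. j < k \<and> k \<le> n \<longrightarrow> b j k = \<zero>\<^bsub>M k\<^esub> \<or> d k (b j k) \<sqsubset>\<^bsub>P k\<^esub> d k (c k k))"
    by metis
  have range: "j \<in> {1..n}" if "j \<in> ?K" for j
    using that by (simp add: strong_pivots_def)
  have "b j \<in> N_ge n M N j" if "j \<in> ?K" for j
    using b c that D.submodule_closed(1)[OF N] by (auto simp: N_ge_def M_ge_def)
  moreover have "b j j = c j j" if "j \<in> ?K" for j
    using b that range[OF that] by auto
  ultimately show ?thesis
    using b c range by (intro exI[of _ b]) auto
qed

text \<open>The rows \<open>b j\<close> are listed by increasing pivot. A suffix then consists of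
  the rows with pivot at least some \<open>j\<close>, and these generate \<open>N_ge n M N j\<close>
  by \<open>N_ge_generated\<close>.\<close>

lemma strong_echelon_matrix_exists:
  assumes N: "submodule N R (dsum n M)" and nz: "N \<noteq> {\<zero>\<^bsub>dsum n M\<^esub>}"
    and g: "\<And>j. j \<in> strong_pivots n M N \<Longrightarrow> \<exists>g. is_g (M j) (P j) (d j) (gr n M N j) g"
  shows "\<exists>B. set B \<subseteq> carrier (dsum n M) \<and> row_module R n M B = N \<and>
    strong_reduced_echelon R n M P d B"
proof -
  let ?K = "strong_pivots n M N"
  obtain b where b: "\<And>j. j \<in> ?K \<Longrightarrow> b j \<in> N_ge n M N j"
    and lead: "\<And>j. j \<in> ?K \<Longrightarrow> b j j \<in> nonzero (M j) (gr n M N j)"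
    and least: "\<And>j. j \<in> ?K \<Longrightarrow> is_g (M j) (P j) (d j) (gr n M N j) (d j (b j j))"
    and small: "\<And>j k. j \<in> ?K \<Longrightarrow> k \<in> ?K \<Longrightarrow> j < k \<Longrightarrow>
      b j k = \<zero>\<^bsub>M k\<^esub> \<or> d k (b j k) \<sqsubset>\<^bsub>P k\<^esub> d k (b k k)"
    using strong_echelon_basis_exists[OF N g] by metis
  have K: "?K \<subseteq> {1..n}" by (auto simp: strong_pivots_def)
  then have "finite ?K" by (rule finite_subset) simp
  then obtain js where js: "sorted_wrt (<) js" "set js = ?K"
    using sorted_list_of_set[of ?K] by (metis strict_sorted_list_of_set)
  have gen: "gr n M N j = {r \<odot>\<^bsub>M j\<^esub> b j j | r. r \<in> carrier R}" if "j \<in> ?K" for j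
    using that K euclidean_module.least_degree_generates[OF euclidean submodule_gr[OF N] lead least]
    by blast
  have bN: "b j \<in> N" "b j \<in> carrier (dsum n M)" if "j \<in> ?K" for j
    using b[OF that] by (auto simp: N_ge_def M_ge_def)
  let ?B = "map b js"
  have B: "set ?B \<subseteq> carrier (dsum n M)" using bN js by auto
  \<comment> \<open>Only the set of rows of \<open>C\<close> matters. The fact serves the whole
    matrix, with \<open>i = 0\<close>, as well as its suffixes.\<close>
  have suffix: "N_ge n M N i = row_module R n M C"
    if C: "set C = b ` {j \<in> ?K. i \<le> j}" for i C
  proof
    have CD: "set C \<subseteq> carrier (dsum n M)" using C bN by auto
    show "N_ge n M N i \<subseteq> row_module R n M C"
      using b gen row_module_superset[OF CD] C
      by (intro N_ge_generated[OF N submodule_row_module[OF CD], where b = b]) auto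
    have "b j \<in> N_ge n M N i" if "j \<in> ?K" "i \<le> j" for j
      using b[OF that(1)] that(2) by (auto simp: N_ge_def M_ge_def)
    then show "row_module R n M C \<subseteq> N_ge n M N i"
      using C by (intro row_module_minimal submodule_N_ge N) auto
  qed
  \<comment> \<open>Columns are numbered from 1, so index 0 imposes no vanishing condition.\<close>
  have "N_ge n M N 0 = N"
    using D.submodule_closed(1)[OF N] by (auto simp: N_ge_def M_ge_def)
  with suffix[of ?B 0] js have row_B: "row_module R n M ?B = N" by simp
  \<comment> \<open>As \<open>js\<close> is strictly increasing, its members from position \<nu> on
    are exactly the pivots not below \<open>js ! \<nu>\<close>.\<close>
  have drop_eq: "set (drop \<nu> ?B) = b ` {j \<in> ?K. js ! \<nu> \<le> j}" if \<nu>: "\<nu> < length js" for \<nu>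
  proof -
    have "set (drop \<nu> js) = {j \<in> set js. js ! \<nu> \<le> j}"
    proof (intro equalityI subsetI)
      fix j assume "j \<in> set (drop \<nu> js)"
      then obtain i where "i < length (drop \<nu> js)" "j = drop \<nu> js ! i"
        unfolding in_set_conv_nth by blast
      then have "\<nu> + i < length js" "j = js ! (\<nu> + i)" using \<nu> by auto
      then show "j \<in> {j \<in> set js. js ! \<nu> \<le> j}"
        using sorted_wrt_nth_less[OF js(1), of \<nu> "\<nu> + i"] by (cases "i = 0") auto
    next
      fix j assume "j \<in> {j \<in> set js. js ! \<nu> \<le> j}"
      then obtain i where i: "i < length js" "j = js ! i" "js ! \<nu> \<le> js ! i"
        by (auto simp: in_set_conv_nth)
      then have "\<nu> \<le> i"
        using sorted_wrt_nth_less[OF js(1), of i \<nu>] \<nu> by fastforce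
      then show "j \<in> set (drop \<nu> js)"
        using i \<nu> by (auto simp: in_set_conv_nth intro!: exI[of _ "i - \<nu>"])
    qed
    then show ?thesis using js(2) by (simp add: drop_map)
  qed
  have not_zero: "?B \<noteq> zero_matrix (length js) n M"
  proof
    assume eq: "?B = zero_matrix (length js) n M"
    \<comment> \<open>Inclusion in place of equality also covers an empty \<open>js\<close>, where
      \<open>?B\<close> has no rows.\<close>
    then have "set ?B \<subseteq> {\<zero>\<^bsub>dsum n M\<^esub>}" by (auto simp: zero_matrix_def set_replicate_conv_if)
    moreover have "submodule {\<zero>\<^bsub>dsum n M\<^esub>} R (dsum n M)" by (rule D.submoduleI) auto
    ultimately have "N \<subseteq> {\<zero>\<^bsub>dsum n M\<^esub>}" using row_module_minimal row_B by blast
    then show False using nz D.submodule_closed(2)[OF N] by auto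
  qed
  \<comment> \<open>The echelon conditions are proved for \<open>N\<close> itself;
    \<open>row_B\<close> identifies it with the row module of \<open>?B\<close>.\<close>
  have row: "let j = js ! \<nu>; c = (?B ! \<nu>) j in
      N_ge n M N j = row_module R n M (drop \<nu> ?B) \<and>
      gr n M N j = {r \<odot>\<^bsub>M j\<^esub> c | r. r \<in> carrier R} \<and>
      c \<in> nonzero (M j) (gr n M N j) \<and>
      is_g (M j) (P j) (d j) (gr n M N j) (d j c) \<and>
      (\<forall>\<mu><\<nu>. (?B ! \<mu>) j = \<zero>\<^bsub>M j\<^esub> \<or> d j ((?B ! \<mu>) j) \<sqsubset>\<^bsub>P j\<^esub> d j c)"
    if \<nu>: "\<nu> < length js" for \<nu>
  proof -
    have j: "js ! \<nu> \<in> ?K" using nth_mem[OF \<nu>] unfolding js(2) .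
    have "(?B ! \<mu>) (js ! \<nu>) = \<zero>\<^bsub>M (js ! \<nu>)\<^esub> \<or>
        d (js ! \<nu>) ((?B ! \<mu>) (js ! \<nu>)) \<sqsubset>\<^bsub>P (js ! \<nu>)\<^esub> d (js ! \<nu>) (b (js ! \<nu>) (js ! \<nu>))"
      if "\<mu> < \<nu>" for \<mu>
    proof -
      have "js ! \<mu> \<in> ?K" "?B ! \<mu> = b (js ! \<mu>)"
        using nth_mem[of \<mu> js] that \<nu> unfolding js(2) by simp_all
      then show ?thesis
        using small[OF _ j sorted_wrt_nth_less[OF js(1) that \<nu>]] by metis
    qed
    with suffix[OF drop_eq[OF \<nu>]] gen[OF j] lead[OF j] least[OF j] show ?thesis
      unfolding Let_def nth_map[OF \<nu>] by blast
  qed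
  have "strong_reduced_echelon R n M P d ?B"
    unfolding strong_reduced_echelon_def row_B
    using B not_zero js row
    by (intro exI[of _ "length js"] exI[of _ js] conjI allI impI row) (simp_all add: matrices_def)
  with B row_B show ?thesis by blast
qed

end

section \<open>Applying the construction to the row module of \<open>A\<close>\<close>

theorem theorem1p4:
  fixes R :: "('a, 'r) ring_scheme"
    and m n :: nat
    and M :: "nat \<Rightarrow> ('a, 'b) module"
    and P :: "nat \<Rightarrow> 'p gorder"
    and d :: "nat \<Rightarrow> 'b \<Rightarrow> 'p"
    and A :: "'b matrix"
    and js :: "nat list"
  assumes "ring R"
    and "\<And>i. i \<in> {1..n} \<Longrightarrow> euclidean_module R (M i) (P i) (d i)"
    and "\<And>i N. \<lbrakk>i \<in> {1..n}; submodule N R (M i); N \<noteq> {\<zero>\<^bsub>M i\<^esub>}\<rbrakk> \<Longrightarrow> \<exists>g. is_g (M i) (P i) (d i) N g"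
    and "A \<in> matrices m n M"
    and "A \<noteq> zero_matrix m n M"
    and "sorted_wrt (<) js"
    and "set js = strong_pivots n M (row_module R n M A)"
  shows "\<exists>B. strongly_row_equiv R n M A B \<and> strong_reduced_echelon R n M P d B"
proof -
  interpret euclidean_dsum R n M P d
    using assms(1,2) by (rule euclidean_dsum.intro)
  let ?N = "row_module R n M A"
  have A: "set A \<subseteq> carrier (dsum n M)" using assms(4) by (simp add: matrices_def)
  have N: "submodule ?N R (dsum n M)" by (rule submodule_row_module[OF A])
  have "?N \<noteq> {\<zero>\<^bsub>dsum n M\<^esub>}"
  proof
    assume "?N = {\<zero>\<^bsub>dsum n M\<^esub>}"
    then have "\<forall>a\<in>set A. a = \<zero>\<^bsub>dsum n M\<^esub>" using row_module_superset[OF A] by auto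
    then have "A = zero_matrix m n M"
      using assms(4) replicate_length_same[of A] by (auto simp: matrices_def zero_matrix_def)
    then show False using assms(5) by simp
  qed
  \<comment> \<open>At a strong pivot the graded piece is a nonzero submodule of \<open>M j\<close>,
    so the assumed existence of least degrees applies to it.\<close>
  moreover have "\<exists>g. is_g (M j) (P j) (d j) (gr n M ?N j) g" if "j \<in> strong_pivots n M ?N" for j
    using that by (intro assms(3) submodule_gr[OF N]) (auto simp: strong_pivots_def)
  ultimately obtain B where "set B \<subseteq> carrier (dsum n M)" "row_module R n M B = ?N"
    "strong_reduced_echelon R n M P d B"
    using strong_echelon_matrix_exists[OF N] by blast
  then show ?thesis using strongly_row_equiv_if_row_module_eq[OF A] by metis
qed

end
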